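(* Up to graph automorphisms of $\Lambda_3$ (translations of $\mathbb{Z}^3$ composed with permutations and sign changes of the coordinates), there is exactly one perfect dominating set (PDS) $S$ of $\Lambda_3$ such that every induced component of $S$ is a $4$-cycle.
   Context: $\Lambda_3$ denotes the unit distance graph of the integer lattice $\mathbb{Z}^3\subset\mathbb{R}^3$: its vertex set is $\mathbb{Z}^3$, and two vertices are adjacent if and only if their Euclidean distance is $1$. For a graph $\Gamma=(V,E)$, a subset $S\subseteq V$ is a PDS of $\Gamma$ if every vertex of $V\setminus S$ has exactly one neighbor in $S$ (no condition is imposed on vertices of $S$; in particular $S$ need not be an independent set). The induced components of $S$ are the connected components of the subgraph of $\Gamma$ induced by $S$. *)

theory Defs
  imports "HOL-Analysis.Analysis"
begin

text \<open>
  A graph is given by an adjacency relation \<open>adj :: 'a \<Rightarrow> 'a \<Rightarrow> bool\<close>; its vertex set is the whole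
  type \<open>'a\<close>.
\<close>

definition perfect_dominating :: "('a \<Rightarrow> 'a \<Rightarrow> bool) \<Rightarrow> 'a set \<Rightarrow> bool" where
  "perfect_dominating adj S \<longleftrightarrow> (\<forall>v. v \<notin> S \<longrightarrow> (\<exists>!w. w \<in> S \<and> adj v w))"

definition induced :: "('a \<Rightarrow> 'a \<Rightarrow> bool) \<Rightarrow> 'a set \<Rightarrow> 'a \<Rightarrow> 'a \<Rightarrow> bool" where
  "induced adj S u v \<longleftrightarrow> u \<in> S \<and> v \<in> S \<and> adj u v"

definition induced_components :: "('a \<Rightarrow> 'a \<Rightarrow> bool) \<Rightarrow> 'a set \<Rightarrow> 'a set set" where
  "induced_components adj S = (\<lambda>u. {v. (induced adj S)\<^sup>*\<^sup>* u v}) ` S"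

text \<open>
  The cycle graph on \<open>{..<n}\<close> (meant for \<open>n \<ge> 3\<close>), and the property that the subgraph induced by
  \<open>C\<close> is isomorphic to it; in particular \<open>C\<close> has no chords.
\<close>

definition cycle_adj :: "nat \<Rightarrow> nat \<Rightarrow> nat \<Rightarrow> bool" where
  "cycle_adj n i j \<longleftrightarrow> j = (i + 1) mod n \<or> i = (j + 1) mod n"

definition induces_cycle :: "('a \<Rightarrow> 'a \<Rightarrow> bool) \<Rightarrow> nat \<Rightarrow> 'a set \<Rightarrow> bool" where
  "induces_cycle adj n C \<longleftrightarrow>
     (\<exists>f. bij_betw f {..<n} C \<and> (\<forall>i<n. \<forall>j<n. adj (f i) (f j) \<longleftrightarrow> cycle_adj n i j))"

definition graph_automorphism :: "('a \<Rightarrow> 'a \<Rightarrow> bool) \<Rightarrow> ('a \<Rightarrow> 'a) \<Rightarrow> bool" where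
  "graph_automorphism adj f \<longleftrightarrow> bij f \<and> (\<forall>u v. adj (f u) (f v) \<longleftrightarrow> adj u v)"

definition embed :: "int ^ 3 \<Rightarrow> real ^ 3" where
  "embed v = (\<chi> i. real_of_int (v $ i))"

definition Lambda3 :: "int ^ 3 \<Rightarrow> int ^ 3 \<Rightarrow> bool" where
  "Lambda3 u v \<longleftrightarrow> dist (embed u) (embed v) = 1"

definition lattice_motion :: "(int ^ 3 \<Rightarrow> int ^ 3) \<Rightarrow> bool" where
  "lattice_motion f \<longleftrightarrow>
     (\<exists>p s t. bij p \<and> (\<forall>i. s i \<in> {1, -1}) \<and> f = (\<lambda>v. t + (\<chi> i. s i * v $ p i)))"

definition four_cycle_pds :: "(int ^ 3) set \<Rightarrow> bool" where
  "four_cycle_pds S \<longleftrightarrow>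
     perfect_dominating Lambda3 S \<and> (\<forall>C \<in> induced_components Lambda3 S. induces_cycle Lambda3 4 C)"

end

theory Submission
  imports Defs
begin

text \<open>
  A unit square together with its neighbours has 20 points, and a set is a perfect dominating set
  with 4-cycle components precisely when these 20-point tiles of its squares partition the lattice.
  Since two tiles overlap iff the squares have \<open>\<ell>\<^sub>1\<close>-distance at most 2, the possible surroundings of
  one square can be explored by branching over the tiles that cover a given point. This finite search
  leaves four surroundings, all by parallel squares, which are equivalent under symmetries of the
  square. Neighbouring squares must have the same one of the four surroundings, for otherwise two of
  their neighbours would overlap. So the squares form the translates of one square by a lattice of
  index 20.
\<close>

subsection \<open>Tiles and the distances between them\<close>

text \<open>The 20 points are the 4 corners, 8 further neighbours in the plane of the square, and 8
  above and below it. The obstacle is that squares of all three orientations may mix and no global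
  structure is given, so everything has to be forced by points close to one square. Every point
  needs one of 60 candidate tiles, and a point all of whose candidates clash with tiles already
  placed refutes a branch. The points to branch on are fixed in advance, so that only the check of a
  given tree is computed; integer triples and gaps, instead of vectors and point sets, keep this
  check within reach of symbolic evaluation. Existence rests on the homomorphism
  \<open>5 x - 6 y + 2 z\<close> to the integers modulo 20: it takes each residue exactly once on
  the 20 points of a tile of a horizontal square, so the translates of that tile by the kernel
  partition the lattice.\<close>

text \<open>
  The tile \<open>(x, y, z, k)\<close> stands for the unit square with least corner \<open>(x, y, z)\<close> orthogonal to the
  axis \<open>k\<close>.
\<close>

type_synonym point = "int \<times> int \<times> int"

datatype axis = AX | AY | AZ

type_synonym tile = "int \<times> int \<times> int \<times> axis"

fun extent :: "axis \<Rightarrow> int \<times> int \<times> int" where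
  "extent AX = (0, 1, 1)"
| "extent AY = (1, 0, 1)"
| "extent AZ = (1, 1, 0)"

text \<open>The distance between the intervals \<open>[0, a]\<close> and \<open>[d, d + b]\<close>.\<close>

definition interval_gap :: "int \<Rightarrow> int \<Rightarrow> int \<Rightarrow> int" where
  "interval_gap d a b = (if a < d then d - a else if d < - b then - d - b else 0)"

fun point_gap :: "point \<Rightarrow> tile \<Rightarrow> int" where
  "point_gap (x, y, z) (x', y', z', k') = (case extent k' of (a', b', c') \<Rightarrow>
     interval_gap (x' - x) 0 a' + interval_gap (y' - y) 0 b' + interval_gap (z' - z) 0 c')"

fun tile_gap :: "tile \<Rightarrow> tile \<Rightarrow> int" where
  "tile_gap (x, y, z, k) (x', y', z', k') =
     (case extent k of (a, b, c) \<Rightarrow> case extent k' of (a', b', c') \<Rightarrow>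
        interval_gap (x' - x) a a' + interval_gap (y' - y) b b' + interval_gap (z' - z) c c')"

definition square :: "tile \<Rightarrow> point set" where
  "square t = {p. point_gap p t = 0}"

fun grid_dist :: "point \<Rightarrow> point \<Rightarrow> int" where
  "grid_dist (x, y, z) (x', y', z') = \<bar>x - x'\<bar> + \<bar>y - y'\<bar> + \<bar>z - z'\<bar>"

definition grid :: "point \<Rightarrow> point \<Rightarrow> bool" where
  "grid p q \<longleftrightarrow> grid_dist p q = 1"

text \<open>Covering and disjointness are expressed through gaps alone: a point lies in the tile of
  \<open>t\<close> iff its distance to the square is at most 1. The 20-point sets themselves never
  occur.\<close>

definition tiling :: "tile set \<Rightarrow> bool" where
  "tiling \<T> \<longleftrightarrow> (\<forall>p. \<exists>t\<in>\<T>. point_gap p t \<le> 1) \<and> (\<forall>t\<in>\<T>. \<forall>u\<in>\<T>. t \<noteq> u \<longrightarrow> 2 < tile_gap t u)"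

text \<open>The witnesses come from clamping: the point of \<open>[0, a]\<close> nearest to
  \<open>d\<close>, and then the point of \<open>[d, d + b]\<close> nearest to that one.\<close>

lemma interval_gap_attained:
  assumes "0 \<le> a" "0 \<le> b"
  shows "\<exists>i j. 0 \<le> i \<and> i \<le> a \<and> 0 \<le> j \<and> j \<le> b \<and> \<bar>i - (d + j)\<bar> = interval_gap d a b"
  using assms
  by (intro exI[of _ "max 0 (min a d)"] exI[of _ "max 0 (min b (max 0 (min a d) - d))"])
    (auto simp: interval_gap_def max_def min_def)

lemma interval_gap_le:
  assumes "0 \<le> i" "i \<le> a" "0 \<le> j" "j \<le> b"
  shows "interval_gap d a b \<le> \<bar>i - (d + j)\<bar>"
  using assms by (auto simp: interval_gap_def)

lemma interval_gap_nonneg [simp]: "0 \<le> a \<Longrightarrow> 0 \<le> b \<Longrightarrow> 0 \<le> interval_gap d a b"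
  by (auto simp: interval_gap_def)

lemma interval_gap_eq_0: "0 \<le> a \<Longrightarrow> 0 \<le> b \<Longrightarrow> interval_gap d a b = 0 \<longleftrightarrow> d \<le> a \<and> - b \<le> d"
  by (auto simp: interval_gap_def)

lemma extent_bounds: "extent k = (a, b, c) \<Longrightarrow> 0 \<le> a \<and> 0 \<le> b \<and> 0 \<le> c"
  by (cases k) auto

lemma mem_square:
  assumes "extent k = (a, b, c)"
  shows "(x', y', z') \<in> square (x, y, z, k) \<longleftrightarrow>
    x \<le> x' \<and> x' \<le> x + a \<and> y \<le> y' \<and> y' \<le> y + b \<and> z \<le> z' \<and> z' \<le> z + c"
proof -
  have nn: "0 \<le> a" "0 \<le> b" "0 \<le> c" using extent_bounds[OF assms] by auto
  have "(x', y', z') \<in> square (x, y, z, k) \<longleftrightarrow> interval_gap (x - x') 0 a = 0 \<and>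
      interval_gap (y - y') 0 b = 0 \<and> interval_gap (z - z') 0 c = 0"
    using nn by (simp add: square_def assms add_nonneg_eq_0_iff)
  then show ?thesis using nn by (auto simp: interval_gap_eq_0)
qed

lemma square_AZ: "square (x, y, z, AZ) = {(x, y, z), (x + 1, y, z), (x + 1, y + 1, z), (x, y + 1, z)}"
  by (auto simp: mem_square)

lemma square_AY: "square (x, y, z, AY) = {(x, y, z), (x + 1, y, z), (x + 1, y, z + 1), (x, y, z + 1)}"
  by (auto simp: mem_square)

lemma square_AX: "square (x, y, z, AX) = {(x, y, z), (x, y + 1, z), (x, y + 1, z + 1), (x, y, z + 1)}"
  by (auto simp: mem_square)

text \<open>The least and the greatest corner of each square lie in the other one, so both corners
  agree, and their difference determines the axis.\<close>

lemma square_inject: 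
  assumes "square t = square u"
  shows "t = u"
proof -
  obtain x y z k x' y' z' k' where t: "t = (x, y, z, k)" and u: "u = (x', y', z', k')"
    by (metis prod_cases4)
  obtain a b c a' b' c' where e: "extent k = (a, b, c)" "extent k' = (a', b', c')"
    by (metis prod_cases3)
  have "(x, y, z) \<in> square t" "(x + a, y + b, z + c) \<in> square t"
    "(x', y', z') \<in> square u" "(x' + a', y' + b', z' + c') \<in> square u"
    using extent_bounds[OF e(1)] extent_bounds[OF e(2)] by (auto simp: t u mem_square[OF e(1)] mem_square[OF e(2)])
  then have "(x, y, z) \<in> square u" "(x + a, y + b, z + c) \<in> square u"
    "(x', y', z') \<in> square t" "(x' + a', y' + b', z' + c') \<in> square t"
    using assms by simp_all
  then have "x = x'" "y = y'" "z = z'" "a = a'" "b = b'" "c = c'"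
    by (auto simp: t u mem_square[OF e(1)] mem_square[OF e(2)])
  moreover then have "k = k'" using e by (cases k; cases k') auto
  ultimately show ?thesis by (simp add: t u)
qed

lemma tile_gap_attained: "\<exists>p\<in>square t. \<exists>q\<in>square u. grid_dist p q = tile_gap t u"
proof -
  obtain x y z k x' y' z' k' where t: "t = (x, y, z, k)" and u: "u = (x', y', z', k')"
    by (metis prod_cases4)
  obtain a b c a' b' c' where e: "extent k = (a, b, c)" "extent k' = (a', b', c')"
    by (metis prod_cases3)
  note bounds = extent_bounds[OF e(1)] extent_bounds[OF e(2)]
  obtain i i' where i: "0 \<le> i" "i \<le> a" "0 \<le> i'" "i' \<le> a'" "\<bar>i - (x' - x + i')\<bar> = interval_gap (x' - x) a a'"
    using interval_gap_attained bounds by metis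
  obtain j j' where j: "0 \<le> j" "j \<le> b" "0 \<le> j'" "j' \<le> b'" "\<bar>j - (y' - y + j')\<bar> = interval_gap (y' - y) b b'"
    using interval_gap_attained bounds by metis
  obtain l l' where l: "0 \<le> l" "l \<le> c" "0 \<le> l'" "l' \<le> c'" "\<bar>l - (z' - z + l')\<bar> = interval_gap (z' - z) c c'"
    using interval_gap_attained bounds by metis
  have "(x + i, y + j, z + l) \<in> square t" "(x' + i', y' + j', z' + l') \<in> square u"
    using i j l by (auto simp: t u mem_square[OF e(1)] mem_square[OF e(2)])
  moreover have "grid_dist (x + i, y + j, z + l) (x' + i', y' + j', z' + l') = tile_gap t u"
    using i(5) j(5) l(5) by (simp add: t u e algebra_simps)
  ultimately show ?thesis by blast
qed

lemma tile_gap_le: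
  assumes "p \<in> square t" "q \<in> square u"
  shows "tile_gap t u \<le> grid_dist p q"
proof -
  obtain x y z k x' y' z' k' where t: "t = (x, y, z, k)" and u: "u = (x', y', z', k')"
    by (metis prod_cases4)
  obtain a b c a' b' c' where e: "extent k = (a, b, c)" "extent k' = (a', b', c')"
    by (metis prod_cases3)
  obtain i j l i' j' l' where p: "p = (x + i, y + j, z + l)" and q: "q = (x' + i', y' + j', z' + l')"
    by (metis prod_cases3 add.commute diff_add_cancel)
  have "interval_gap (x' - x) a a' \<le> \<bar>i - (x' - x + i')\<bar>" "interval_gap (y' - y) b b' \<le> \<bar>j - (y' - y + j')\<bar>"
    "interval_gap (z' - z) c c' \<le> \<bar>l - (z' - z + l')\<bar>"
    using assms by (auto intro!: interval_gap_le simp: t u p q mem_square[OF e(1)] mem_square[OF e(2)])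
  then show ?thesis by (simp add: t u p q e algebra_simps)
qed

lemma point_gap_le:
  assumes "q \<in> square t"
  shows "point_gap p t \<le> grid_dist p q"
proof -
  obtain x y z k where t: "t = (x, y, z, k)" by (metis prod_cases4)
  obtain a b c where e: "extent k = (a, b, c)" by (metis prod_cases3)
  obtain x' y' z' where p: "p = (x', y', z')" by (metis prod_cases3)
  obtain i j l where q: "q = (x + i, y + j, z + l)"
    by (metis prod_cases3 add.commute diff_add_cancel)
  have "interval_gap (x - x') 0 a \<le> \<bar>0 - (x - x' + i)\<bar>" "interval_gap (y - y') 0 b \<le> \<bar>0 - (y - y' + j)\<bar>"
    "interval_gap (z - z') 0 c \<le> \<bar>0 - (z - z' + l)\<bar>"
    by (rule interval_gap_le; use assms in \<open>simp add: t p q mem_square[OF e]\<close>)+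
  then show ?thesis by (simp add: t p q e algebra_simps)
qed

section \<open>Translations of tiles and tilings\<close>

fun shift :: "point \<Rightarrow> tile \<Rightarrow> tile" where
  "shift (a, b, c) (x, y, z, k) = (a + x, b + y, c + z, k)"

lemma tile_gap_shift [simp]: "tile_gap (shift v t) (shift v u) = tile_gap t u"
  by (cases "(v, t)" rule: shift.cases; cases "(v, u)" rule: shift.cases) auto

lemma point_gap_shift: "point_gap (a + x, b + y, c + z) (shift (a, b, c) t) = point_gap (x, y, z) t"
  by (cases "((a, b, c), t)" rule: shift.cases) auto

lemma shift_inject [simp]: "shift v t = shift v u \<longleftrightarrow> t = u"
  by (cases "(v, t)" rule: shift.cases; cases "(v, u)" rule: shift.cases) auto

lemma surj_shift: "\<exists>u. t = shift v u"
proof -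
  obtain x y z k where t: "t = (x, y, z, k)" by (metis prod_cases4)
  obtain a b c where v: "v = (a, b, c)" by (metis prod_cases3)
  show ?thesis by (rule exI[of _ "(x - a, y - b, z - c, k)"]) (simp add: t v)
qed

text \<open>Moves any square of a tiling to the origin, so that a single search around the origin
  serves for all of them.\<close>

lemma tiling_shift:
  assumes "tiling \<T>"
  shows "tiling {t. shift v t \<in> \<T>}"
  unfolding tiling_def
proof (intro conjI allI ballI impI)
  fix p :: point
  obtain x y z a b c where p: "p = (x, y, z)" and v: "v = (a, b, c)" by (metis prod_cases3)
  obtain u where u: "u \<in> \<T>" "point_gap (a + x, b + y, c + z) u \<le> 1"
    using assms unfolding tiling_def by blast
  moreover obtain t where "u = shift (a, b, c) t" using surj_shift by blast
  ultimately show "\<exists>t\<in>{t. shift v t \<in> \<T>}. point_gap p t \<le> 1"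
    unfolding p v by (metis mem_Collect_eq point_gap_shift)
next
  fix t u assume "t \<in> {t. shift v t \<in> \<T>}" "u \<in> {t. shift v t \<in> \<T>}" "t \<noteq> u"
  then have "shift v t \<in> \<T>" "shift v u \<in> \<T>" "shift v t \<noteq> shift v u" by simp_all
  then have "2 < tile_gap (shift v t) (shift v u)"
    using assms unfolding tiling_def by blast
  then show "2 < tile_gap t u" by simp
qed

subsection \<open>Exhaustive search for local tilings\<close>

text \<open>For each of the three orientations there are 20 positions whose tile contains the
  origin. The coordinates start at -2 because a position names the least corner: one unit for the
  extent of the square and one for the distance. The list is spelled out so that the search does not
  filter the 192 candidates again at every node.\<close>

definition offsets :: "tile list" where
  "offsets =
    [(- 2, - 1, 0, AZ), (- 2, 0, - 1, AY), (- 2, 0, 0, AY), (- 2, 0, 0, AZ),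
     (- 1, - 2, 0, AZ), (- 1, - 1, - 1, AX), (- 1, - 1, - 1, AY), (- 1, - 1, - 1, AZ),
     (- 1, - 1, 0, AX), (- 1, - 1, 0, AY), (- 1, - 1, 0, AZ), (- 1, - 1, 1, AZ),
     (- 1, 0, - 2, AY), (- 1, 0, - 1, AX), (- 1, 0, - 1, AY), (- 1, 0, - 1, AZ),
     (- 1, 0, 0, AX), (- 1, 0, 0, AY), (- 1, 0, 0, AZ), (- 1, 0, 1, AY), (- 1, 0, 1, AZ),
     (- 1, 1, - 1, AY), (- 1, 1, 0, AY), (- 1, 1, 0, AZ), (0, - 2, - 1, AX),
     (0, - 2, 0, AX), (0, - 2, 0, AZ), (0, - 1, - 2, AX), (0, - 1, - 1, AX),
     (0, - 1, - 1, AY), (0, - 1, - 1, AZ), (0, - 1, 0, AX), (0, - 1, 0, AY),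
     (0, - 1, 0, AZ), (0, - 1, 1, AX), (0, - 1, 1, AZ), (0, 0, - 2, AX), (0, 0, - 2, AY),
     (0, 0, - 1, AX), (0, 0, - 1, AY), (0, 0, - 1, AZ), (0, 0, 0, AX), (0, 0, 0, AY),
     (0, 0, 0, AZ), (0, 0, 1, AX), (0, 0, 1, AY), (0, 0, 1, AZ), (0, 1, - 1, AX),
     (0, 1, - 1, AY), (0, 1, 0, AX), (0, 1, 0, AY), (0, 1, 0, AZ), (1, - 1, - 1, AX),
     (1, - 1, 0, AX), (1, - 1, 0, AZ), (1, 0, - 1, AX), (1, 0, - 1, AY), (1, 0, 0, AX),
     (1, 0, 0, AY), (1, 0, 0, AZ)]"

lemma offsets_eq:
  "offsets = filter (\<lambda>t. point_gap (0, 0, 0) t \<le> 1) (List.product [- 2, - 1, 0, 1]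
    (List.product [- 2, - 1, 0, 1] (List.product [- 2, - 1, 0, 1] [AX, AY, AZ])))"
  by code_simp

definition cover :: "point \<Rightarrow> tile list" where
  "cover = (\<lambda>(x, y, z). map (\<lambda>(a, b, c, k). (x + a, y + b, z + c, k))
    offsets)"

text \<open>The conditional, in place of a conjunction, lets symbolic evaluation stop at the first
  clash.\<close>

primrec compatible :: "tile list \<Rightarrow> tile \<Rightarrow> bool" where
  "compatible [] t \<longleftrightarrow> True"
| "compatible (u # us) t \<longleftrightarrow> (if 2 < tile_gap t u then compatible us t else False)"

text \<open>A depth-first search whose last argument is the stack of partial tilings still to be
  refuted or recognised; each entry of the certificate consumes the top one. If no compatible tile
  covers the chosen point, nothing is pushed and the branch is closed. The certificate may end only
  with an empty stack, so no branch is forgotten.\<close>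

primrec search :: "tile list list \<Rightarrow> point option list \<Rightarrow> tile list list \<Rightarrow> bool" where
  "search Gs [] Ts \<longleftrightarrow> (case Ts of [] \<Rightarrow> True | _ \<Rightarrow> False)"
| "search Gs (s # ss) Ts \<longleftrightarrow> (case Ts of [] \<Rightarrow> False | T # Ts' \<Rightarrow>
    (case s of
      None \<Rightarrow> list_ex (\<lambda>G. list_all (\<lambda>t. t \<in> set T) G) Gs \<and> search Gs ss Ts'
    | Some p \<Rightarrow> list_all (\<lambda>u. 1 < point_gap p u) T \<and>
        search Gs ss (map (\<lambda>t. t # T) (filter (compatible T) (cover p)) @ Ts')))"

lemma interval_gap_point_le_1:
  assumes "interval_gap d 0 b \<le> 1" "0 \<le> b" "b \<le> 1"
  shows "d \<in> set [- 2, - 1, 0, 1]"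
  using assms by (auto simp: interval_gap_def split: if_splits)

lemma cover_complete:
  assumes "point_gap p t \<le> 1"
  shows "t \<in> set (cover p)"
proof -
  obtain x y z where p: "p = (x, y, z)" by (metis prod_cases3)
  obtain x' y' z' k where "t = (x', y', z', k)" by (metis prod_cases4)
  then obtain a b c where t: "t = (x + a, y + b, z + c, k)"
    by (metis add.commute diff_add_cancel)
  obtain a' b' c' where e: "extent k = (a', b', c')" by (metis prod_cases3)
  have b: "0 \<le> a'" "0 \<le> b'" "0 \<le> c'" "a' \<le> 1" "b' \<le> 1" "c' \<le> 1"
    using e by (cases k; auto)+
  have s: "interval_gap a 0 a' + interval_gap b 0 b' + interval_gap c 0 c' \<le> 1"
    using assms by (simp add: p t e)
  moreover have "0 \<le> interval_gap a 0 a'" "0 \<le> interval_gap b 0 b'" "0 \<le> interval_gap c 0 c'"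
    using b by auto
  ultimately have "interval_gap a 0 a' \<le> 1" "interval_gap b 0 b' \<le> 1" "interval_gap c 0 c' \<le> 1"
    by linarith+
  then have "a \<in> set [- 2, - 1, 0, 1]" "b \<in> set [- 2, - 1, 0, 1]" "c \<in> set [- 2, - 1, 0, 1]"
    using b by (metis interval_gap_point_le_1)+
  moreover have "k \<in> set [AX, AY, AZ]" by (cases k) auto
  ultimately have "(a, b, c, k) \<in> set (List.product [- 2, - 1, 0, 1]
      (List.product [- 2, - 1, 0, 1] (List.product [- 2, - 1, 0, 1] [AX, AY, AZ])))"
    by (simp only: set_product mem_Times_iff fst_conv snd_conv simp_thms)
  moreover have "point_gap (0, 0, 0) (a, b, c, k) \<le> 1" using s by (simp add: e)
  ultimately have "(a, b, c, k) \<in> set offsets"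
    by (simp only: offsets_eq set_filter mem_Collect_eq simp_thms)
  then show ?thesis unfolding cover_def p t by force
qed

lemma compatible_iff: "compatible T t \<longleftrightarrow> (\<forall>u\<in>set T. 2 < tile_gap t u)"
  by (induction T) auto

text \<open>The invariant is that some partial tiling on the stack is contained in
  \<open>\<T>\<close>. When it is on top and \<open>p\<close> is the branching point, the tile of
  \<open>\<T>\<close> covering \<open>p\<close> is new, because \<open>p\<close> is far from all
  placed tiles; hence it is compatible with them and its extension is among those pushed.\<close>

lemma search_sound:
  assumes "tiling \<T>" "search Gs ss Ts" "T \<in> set Ts" "set T \<subseteq> \<T>"
  shows "\<exists>G\<in>set Gs. set G \<subseteq> \<T>"
  using assms(2-4)
proof (induction ss arbitrary: Ts T)
  case Nil
  then show ?case by (simp split: list.splits)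
next
  case (Cons s ss)
  obtain U Ts' where Ts: "Ts = U # Ts'"
    using Cons.prems by (cases Ts) auto
  show ?case
  proof (cases s)
    case None
    then show ?thesis
      using Cons.prems Cons.IH[of Ts' T] by (auto simp: Ts list_ex_iff list_all_iff)
  next
    case (Some p)
    have far: "\<forall>u\<in>set U. 1 < point_gap p u"
      and rest: "search Gs ss (map (\<lambda>t. t # U) (filter (compatible U) (cover p)) @ Ts')"
      using Cons.prems by (auto simp: Ts Some list_all_iff)
    show ?thesis
    proof (cases "T \<in> set Ts'")
      case True
      then show ?thesis using Cons.IH[OF rest, of T] Cons.prems by auto
    next
      case False
      then have T: "T = U" using Cons.prems by (simp add: Ts)
      obtain t where t: "t \<in> \<T>" "point_gap p t \<le> 1"
        using assms(1) unfolding tiling_def by blast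
      have "compatible U t"
        unfolding compatible_iff
      proof
        fix u assume u: "u \<in> set U"
        then have "t \<noteq> u" using far t by auto
        then show "2 < tile_gap t u"
          using assms(1) t u Cons.prems T unfolding tiling_def by blast
      qed
      then have "t # U \<in> set (map (\<lambda>t. t # U) (filter (compatible U) (cover p)) @ Ts')"
        using cover_complete[OF t(2)] by auto
      then show ?thesis using Cons.IH[OF rest] t Cons.prems T by auto
    qed
  qed
qed

subsection \<open>The surroundings of a square\<close>

text \<open>The lattice \<open>5 x - 6 y + 2 z \<equiv> 0 (mod 20)\<close> is generated by the first three of these vectors.\<close>

definition star :: "point list" where
  "star = [(0, 3, - 1), (2, 2, 1), (2, 1, - 2), (0, - 3, 1), (- 2, - 2, - 1), (- 2, - 1, 2)]"

fun swap_xy :: "point \<Rightarrow> point" where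
  "swap_xy (x, y, z) = (y, x, z)"

fun flip_z :: "point \<Rightarrow> point" where
  "flip_z (x, y, z) = (x, y, - z)"

text \<open>Of the symmetries of the square at the origin, these representatives are involutions
  that fix its least corner. They therefore send the horizontal square with corner \<open>v\<close>
  to the one whose corner is the image of \<open>v\<close>, without any correcting
  translation.\<close>

definition other_stars :: "point list list" where
  "other_stars = [map swap_xy star, map flip_z star, map (swap_xy \<circ> flip_z) star]"

fun flat :: "point \<Rightarrow> tile" where
  "flat (x, y, z) = (x, y, z, AZ)"

lemma shift_flat [simp]: "shift v (flat w) = flat (v + w)"
  by (cases v; cases w) auto

text \<open>The reason why the choice of a star spreads: a neighbour \<open>g\<close> of the origin
  with a different star would have a tile that overlaps the tile at the origin or one of its star.
  Coinciding tiles are no conflict and are excluded.\<close>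

lemma stars_clash:
  "list_all (\<lambda>g. list_all (\<lambda>G. list_ex (\<lambda>s. list_ex (\<lambda>w. flat s \<noteq> shift g (flat w) \<and>
     tile_gap (flat s) (shift g (flat w)) \<le> 2) G) ((0, 0, 0) # star)) other_stars) star"
  by code_simp

text \<open>
  The search tree in preorder: \<open>Some p\<close> branches over the tiles covering \<open>p\<close>, and \<open>None\<close> marks a
  leaf in which one of the four stars has been placed.
\<close>

definition certificate :: "point option list" where
  "certificate =
    [Some (0, - 1, 1), Some (1, - 1, 1), Some (0, 0, 2), Some (2, 0, 1), Some (0, 0, 2),
     Some (2, 0, 3), Some (1, 1, 2), Some (1, 1, 2), Some (0, 2, 1), Some (- 2, 0, 2),
     Some (- 2, 0, 0), Some (- 3, 1, 0), Some (- 3, - 1, 0), Some (- 3, 2, 0), Some (2, - 1, 0),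
     Some (0, - 1, - 1), Some (1, - 2, 0), Some (2, - 3, 1), Some (4, - 1, 0),
     Some (0, - 1, - 1), Some (- 1, - 3, - 1), Some (1, 0, - 2), Some (- 1, 0, - 3),
     Some (- 1, 0, - 3), Some (0, 1, - 2), Some (0, 1, - 2), Some (0, 3, 0), Some (1, 2, - 1),
     None, Some (0, - 2, - 1), Some (1, - 3, - 2), Some (0, - 1, - 1), Some (- 1, - 1, - 1),
     Some (- 3, 1, 0), Some (2, 0, 3), Some (0, 0, 2), Some (0, - 1, 2), Some (0, 0, 2),
     Some (1, 0, 2), Some (1, - 1, 2), Some (1, 0, 2), Some (1, 0, 2), Some (- 1, 0, 2),
     Some (1, 1, 2), Some (0, 2, 1), Some (0, - 2, 2), Some (0, - 2, 0), Some (1, - 3, 0),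
     Some (- 1, - 3, 0), Some (2, - 3, 0), Some (2, 2, 0), Some (2, 0, - 1), Some (3, 1, 0),
     Some (1, 3, - 1), Some (3, 1, 0), Some (2, 4, 0), Some (3, 3, 1), Some (- 1, 2, 0),
     Some (0, 3, - 1), Some (- 2, 1, 0), Some (- 1, 4, 0), Some (- 2, 3, 1), Some (- 1, 0, - 1),
     None, Some (- 3, 1, - 2), Some (- 2, 0, - 1), Some (- 1, 0, - 1), Some (- 2, 1, 0),
     Some (1, - 3, 0), Some (0, - 2, 2), Some (0, - 1, 2), Some (0, - 1, 2), Some (0, 0, 2),
     Some (1, 0, 2), Some (0, 0, 2), Some (1, 0, 2), Some (1, 1, 2), Some (1, - 1, 1),
     Some (2, - 1, 1), Some (1, - 1, 2), Some (0, 1, 2), Some (1, 1, 2), Some (- 1, 1, 2),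
     Some (- 1, 1, 1), Some (1, - 1, 1), Some (0, - 2, 0), Some (- 2, - 2, 0),
     Some (1, - 1, - 1), Some (2, 0, - 1), Some (2, - 2, - 1), Some (2, - 2, 0),
     Some (1, - 1, - 1), Some (2, - 2, 0), Some (- 1, - 2, 0), Some (1, - 1, 2),
     Some (2, - 1, 0), Some (2, - 1, 3), Some (3, - 2, 0), Some (3, - 3, 2), Some (4, - 2, - 1),
     Some (0, - 1, - 1), Some (1, - 3, 0), Some (1, - 3, 0), Some (2, - 3, - 1),
     Some (3, - 3, 1), Some (2, - 3, 0), Some (2, 0, 2), Some (2, 0, 1), Some (0, - 2, 1),
     Some (1, - 2, 0), Some (0, - 2, 0), Some (1, - 2, 0), Some (1, - 3, 0), Some (1, - 1, 2),
     Some (2, 1, 1), Some (0, 3, 1), Some (1, 3, 0), Some (0, 3, 0), Some (1, 3, 0),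
     Some (1, 4, 0), Some (0, 3, 1), Some (1, 3, 1), Some (1, 3, 2), Some (1, 3, 1),
     Some (0, 3, 0), Some (1, 3, 0), Some (2, 3, 0), Some (1, 3, 2), Some (2, 1, 2),
     Some (- 1, 1, 2), Some (- 2, 1, 1), Some (- 2, 1, 2), Some (- 2, 1, 0), Some (- 3, 0, 0),
     Some (- 2, 0, 0), Some (1, - 1, 1), Some (2, 0, 1), Some (- 1, - 1, 0), Some (- 1, 0, - 1),
     Some (0, - 1, - 1), Some (- 2, - 2, 0), Some (0, 0, 2), Some (- 2, - 1, 1),
     Some (- 2, - 1, 1), Some (- 2, - 1, 1), Some (1, - 2, 2), Some (0, - 1, 2),
     Some (1, - 1, 1), Some (1, 0, 2), Some (0, 1, 2), Some (1, 1, 2), Some (- 1, 1, 1),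
     Some (- 1, 2, 1), Some (- 1, 1, 2), Some (2, 1, 1), Some (0, 2, 1), Some (0, 3, 1),
     Some (0, 3, 2), Some (1, 3, 0), Some (1, 4, 0), Some (0, 3, 0), Some (0, 2, 2),
     Some (- 2, 1, 1), Some (- 2, 1, 2), Some (- 2, 1, 2), Some (- 2, 0, 2), Some (- 2, 1, 2),
     Some (- 2, 0, 0), Some (- 2, 1, 0), Some (- 2, 2, 0), Some (3, 0, 1), Some (3, 1, 0),
     Some (3, 1, 0), Some (4, 1, 0), Some (3, 0, 0), Some (1, 2, 2), Some (2, 2, 0),
     Some (3, 3, 0), Some (4, 3, 1), Some (4, 2, 0), Some (3, 4, - 1), Some (2, 2, 3),
     Some (4, 3, 2), Some (1, 2, 1), Some (3, 4, 1), Some (2, 3, 2), Some (2, 4, 3),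
     Some (3, 4, 1), Some (1, 2, 1), Some (3, 0, 0), Some (2, 1, - 1), Some (3, 2, 0),
     Some (3, - 2, 0), Some (2, 1, - 1), Some (1, 2, - 1), Some (2, 2, 0), Some (3, 2, 0),
     Some (3, - 1, 0), Some (2, 1, 2), Some (0, - 1, 3), Some (1, - 1, 2), Some (1, 0, 2),
     Some (1, - 2, 2), Some (1, - 2, 1), Some (1, - 2, 2), Some (0, - 2, 0), Some (1, - 2, 0),
     Some (0, - 3, 0), Some (1, - 1, 1), Some (- 1, - 1, 0), Some (- 1, 0, 1),
     Some (- 2, - 2, 0), Some (- 2, - 3, 1), Some (- 2, - 3, - 1), Some (- 3, - 2, - 1),
     Some (- 1, 0, 1), Some (- 3, - 1, 0), Some (- 3, - 1, 0), Some (- 3, - 1, 0),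
     Some (1, - 1, 1), Some (- 1, 0, 1), Some (1, 0, 2), Some (- 1, 0, 3), Some (- 1, 0, 3),
     Some (0, 1, 2), Some (0, 1, 2), Some (2, 1, 1), Some (3, 0, 2), Some (- 1, - 1, 0),
     Some (0, - 2, 0), Some (- 1, - 3, 1), Some (- 3, - 1, 0), Some (1, - 1, - 1),
     Some (0, - 3, - 2), Some (3, 0, 0), Some (2, - 3, - 1), Some (4, - 1, 0), Some (4, 2, 0),
     Some (0, 0, - 2), Some (2, 0, - 3), Some (1, 1, - 2), Some (- 1, 2, 0), Some (0, 3, 0),
     Some (1, 2, - 1), None, Some (2, 0, - 3), Some (1, - 2, - 1), Some (1, - 1, - 1),
     Some (0, - 2, 0), Some (- 2, - 1, 0), Some (- 1, 0, 1), Some (1, - 1, 1), Some (2, - 1, 0),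
     Some (3, - 2, 0), Some (1, 0, 2), Some (3, - 1, 1), Some (3, - 1, 1), Some (3, - 1, 1),
     Some (2, 0, - 1), Some (2, - 2, - 1), Some (1, 0, 2), Some (1, - 1, 1), Some (1, 0, 2),
     Some (1, - 2, 3), Some (1, - 2, 0), Some (2, - 2, 0), Some (3, - 2, 0), Some (0, - 1, - 1),
     Some (- 1, - 2, 0), Some (- 1, 0, - 1), Some (- 1, - 2, - 1), Some (0, - 1, - 1),
     Some (- 1, - 2, 0), Some (1, - 2, 3), Some (- 1, - 1, 0), Some (- 1, - 1, 1),
     Some (- 2, 0, 1), Some (- 1, 2, 0), Some (- 2, 1, - 1), Some (0, 2, - 1),
     Some (- 2, 2, - 1), Some (- 1, - 2, 0), Some (- 1, 0, 1), Some (0, - 1, 2),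
     Some (- 1, - 1, 1), Some (- 1, 0, - 1), Some (0, - 1, - 1), Some (- 1, - 3, 0),
     Some (- 1, - 1, 1), Some (- 1, - 3, 2), Some (- 1, 1, 1), Some (- 2, 0, 0),
     Some (- 2, - 2, 1), Some (0, 1, 2), Some (0, - 1, 3), Some (1, 0, 2), Some (- 1, 2, 3),
     Some (1, 0, 2), Some (1, 2, 1), Some (0, 3, 2), Some (0, 3, 0), Some (1, 4, 0),
     Some (1, 4, 0), Some (- 1, 4, 0), Some (2, 4, 0), Some (2, - 1, 0), Some (2, 1, - 1),
     Some (3, 0, 0), Some (3, 0, 0), Some (2, - 3, 0), Some (3, - 2, 1), Some (- 1, 1, - 1),
     Some (0, 0, - 2), Some (- 2, 3, - 1), Some (0, 0, - 2), Some (1, 0, - 2), Some (1, 1, - 2),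
     None, Some (0, 2, - 3), Some (0, 0, - 2), Some (2, 1, - 1), Some (- 1, - 3, 2),
     Some (- 2, - 2, 1), Some (- 1, - 2, 0), Some (- 1, - 3, 0), Some (0, 0, - 2),
     Some (1, 0, - 2), Some (1, 1, - 2), Some (1, - 1, - 2), Some (0, 1, - 2), Some (1, 1, - 2),
     Some (- 1, 1, - 1), Some (- 1, 2, - 1), Some (- 1, 1, - 2), Some (1, - 1, - 1),
     Some (2, - 3, 0), Some (1, - 3, - 1), Some (0, - 3, - 1), Some (1, - 3, - 1),
     Some (0, - 3, - 2), Some (3, - 3, - 2), Some (3, - 1, 0), Some (2, 1, 1), Some (2, - 2, 2),
     Some (3, - 3, 2), Some (3, 0, 0), Some (2, 1, 1), Some (2, - 1, 2), Some (3, 1, 2),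
     Some (2, 0, 2), Some (1, - 1, - 2), Some (1, - 2, - 1), Some (0, - 3, - 1),
     Some (- 1, - 1, 1), Some (- 1, 0, 1), Some (0, - 1, 3), Some (- 1, - 2, 0),
     Some (- 2, - 2, - 1), Some (- 1, - 1, - 1), Some (0, - 1, - 1), Some (- 1, 0, 1),
     Some (- 1, - 1, 0), Some (- 1, - 1, 2), Some (0, 0, 2), Some (- 1, 1, 1),
     Some (- 1, - 1, 0), Some (- 2, - 2, 0), Some (- 2, - 3, - 1), Some (- 1, - 3, 0),
     Some (- 1, - 3, 1), Some (1, - 1, 1), Some (1, 0, 2), Some (- 1, 0, 1), Some (- 1, 1, 1),
     Some (0, 2, 1), Some (0, 0, 3), Some (- 1, - 1, 3), Some (- 1, 0, 2), Some (- 1, - 1, 1),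
     Some (- 1, - 1, 1), Some (- 1, - 1, 1), Some (- 1, 0, 1), Some (- 1, 0, 2), Some (0, 2, 1),
     Some (- 1, - 1, 0), Some (0, - 2, 1), Some (- 2, - 2, 0), Some (- 1, - 2, 1),
     Some (- 1, 1, 1), Some (0, 1, 2), Some (- 1, 0, 2), Some (- 1, - 1, 1), Some (- 1, 0, 3),
     Some (- 2, - 1, 0), Some (- 2, - 2, - 1), Some (- 1, - 1, - 1), Some (- 1, 0, - 1)]"

text \<open>Only four branches end in a \<open>None\<close>; all others end in a point that cannot
  be covered. Since the accepted leaves contain a list of horizontal squares, the check also
  disposes of mixed orientations in these positions.\<close>

lemma search_certificate:
  "search (map (map flat) (star # other_stars)) certificate [[flat (0, 0, 0)]]"
  by code_simp

lemma flat_neighbours: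
  assumes "tiling \<T>" "flat v \<in> \<T>"
  shows "\<exists>G\<in>set (star # other_stars). \<forall>w\<in>set G. flat (v + w) \<in> \<T>"
proof -
  have "flat (0, 0, 0) \<in> {t. shift v t \<in> \<T>}"
    using assms(2) by (cases v) simp
  then have "\<exists>G\<in>set (map (map flat) (star # other_stars)). set G \<subseteq> {t. shift v t \<in> \<T>}"
    by (intro search_sound[OF tiling_shift[OF assms(1)] search_certificate]) auto
  then obtain G where G: "G \<in> set (star # other_stars)" "set (map flat G) \<subseteq> {t. shift v t \<in> \<T>}"
    unfolding set_map bex_simps by blast
  have "flat (v + w) \<in> \<T>" if "w \<in> set G" for w
  proof -
    have "flat w \<in> {t. shift v t \<in> \<T>}" using that G(2) unfolding set_map by blast
    then show ?thesis by (simp del: flat.simps)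
  qed
  then show ?thesis using G(1) by blast
qed

section \<open>Propagation of one star along its lattice\<close>

definition starred :: "tile set \<Rightarrow> point \<Rightarrow> bool" where
  "starred \<T> v \<longleftrightarrow> flat v \<in> \<T> \<and> (\<forall>w\<in>set star. flat (v + w) \<in> \<T>)"

lemma starred_step:
  assumes T: "tiling \<T>" and v: "starred \<T> v" and g: "g \<in> set star"
  shows "starred \<T> (v + g)"
proof -
  have vg: "flat (v + g) \<in> \<T>" using v g unfolding starred_def by blast
  obtain G where G: "G \<in> set (star # other_stars)" "\<forall>w\<in>set G. flat (v + g + w) \<in> \<T>"
    using flat_neighbours[OF T vg] by blast
  have "G \<notin> set other_stars"
  proof
    assume "G \<in> set other_stars"
    then obtain s w where s: "s \<in> set ((0, 0, 0) # star)" and w: "w \<in> set G"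
      and ne: "flat s \<noteq> shift g (flat w)" and close: "tile_gap (flat s) (shift g (flat w)) \<le> 2"
      using stars_clash g unfolding list_all_iff list_ex_iff by blast
    have "flat (v + s) \<in> \<T>"
      using s v unfolding starred_def by (auto simp flip: zero_prod_def)
    moreover have "flat (v + g + w) \<in> \<T>" using G w by blast
    \<comment> \<open>The clash was computed around the origin; it carries over to \<open>v\<close>
      because shifting is injective and preserves gaps.\<close>
    moreover have "flat (v + s) \<noteq> flat (v + g + w)"
      using ne shift_inject[of v "flat s" "shift g (flat w)"] by (simp add: add.assoc)
    moreover have "tile_gap (flat (v + s)) (flat (v + g + w)) \<le> 2"
      using close tile_gap_shift[of v "flat s" "shift g (flat w)"] by (simp add: add.assoc)
    ultimately show False
      using T unfolding tiling_def by force
  qed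
  then show ?thesis using G vg unfolding starred_def by auto
qed

text \<open>Having both a vector and its negative in \<open>star\<close> permits steps in either
  direction, hence induction over all integers \<open>n\<close>.\<close>

lemma starred_multiple:
  assumes T: "tiling \<T>" and v: "starred \<T> v" and g: "(a, b, c) \<in> set star" "(- a, - b, - c) \<in> set star"
  shows "starred \<T> (v + (n * a, n * b, n * c))"
proof (induction n rule: int_induct[of _ 0])
  case base
  then show ?case using v by (simp flip: zero_prod_def)
next
  case (step1 n)
  have *: "v + ((n + 1) * a, (n + 1) * b, (n + 1) * c) = v + (n * a, n * b, n * c) + (a, b, c)"
    by (cases v) (simp add: algebra_simps)
  then show ?case using starred_step[OF T step1(2) g(1)] by (simp only: *)
next
  case (step2 n)
  have *: "v + ((n - 1) * a, (n - 1) * b, (n - 1) * c) = v + (n * a, n * b, n * c) + (- a, - b, - c)"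
    by (cases v) (simp add: algebra_simps)
  then show ?case using starred_step[OF T step2(2) g(2)] by (simp only: *)
qed

fun residue :: "point \<Rightarrow> int" where
  "residue (x, y, z) = (5 * x - 6 * y + 2 * z) mod 20"

lemma starred_lattice:
  assumes T: "tiling \<T>" and "starred \<T> (0, 0, 0)" and "residue v = 0"
  shows "flat v \<in> \<T>"
proof -
  obtain x y z where v: "v = (x, y, z)" by (metis prod_cases3)
  have "20 dvd 5 * x - 6 * y + 2 * z" using assms(3) by (auto simp: v)
  then obtain m where m: "5 * x - 6 * y + 2 * z = 20 * m" by blast
  then have "even x" by presburger
  then obtain h where h: "x = 2 * h" by blast
  have z: "z = 3 * y + 10 * m - 5 * h" using m h by linarith
  \<comment> \<open>The coefficients solve the linear system that expresses \<open>v\<close> in the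
    generators \<open>(0, 3, - 1)\<close>, \<open>(2, 2, 1)\<close> and \<open>(2, 1, - 2)\<close>.
    Their determinant is 20, and divisibility by 20 is what makes the solution integral.\<close>
  let ?w = "(0, 0, 0) + (- m * 0, - m * 3, - m * - 1)
    + ((y + 3 * m - h) * 2, (y + 3 * m - h) * 2, (y + 3 * m - h) * 1)
    + ((2 * h - y - 3 * m) * 2, (2 * h - y - 3 * m) * 1, (2 * h - y - 3 * m) * - 2)"
  have "?w = v" by (simp add: v h z algebra_simps)
  moreover have "starred \<T> ?w"
    by (intro starred_multiple[OF T] assms(2)) (auto simp: star_def)
  ultimately have "starred \<T> v" by (simp only:)
  then show ?thesis unfolding starred_def by blast
qed

subsection \<open>Four-cycles in the grid\<close>

text \<open>The adjacency is a parameter so that the property can be moved between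
  \<open>grid\<close> on triples and \<open>Lambda3\<close> on vectors.\<close>

definition four_cycle_pds_on :: "('a \<Rightarrow> 'a \<Rightarrow> bool) \<Rightarrow> 'a set \<Rightarrow> bool" where
  "four_cycle_pds_on adj S \<longleftrightarrow>
     perfect_dominating adj S \<and> (\<forall>C \<in> induced_components adj S. induces_cycle adj 4 C)"

lemma induced_reachable_image:
  assumes "\<And>u v. adj u v \<Longrightarrow> adj' (f u) (f v)" "(induced adj S)\<^sup>*\<^sup>* u v"
  shows "(induced adj' (f ` S))\<^sup>*\<^sup>* (f u) (f v)"
  using assms(2)
proof induction
  case (step v w)
  then have "induced adj' (f ` S) (f v) (f w)"
    using assms(1) by (auto simp: induced_def)
  with step.IH show ?case by (rule rtranclp.rtrancl_into_rtrancl)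
qed simp

text \<open>Invariance under graph isomorphism, used both for the change of coordinates and for
  lattice motions.\<close>

lemma four_cycle_pds_on_image:
  assumes f: "bij f" and adj: "\<And>u v. adj' (f u) (f v) \<longleftrightarrow> adj u v" and S: "four_cycle_pds_on adj S"
  shows "four_cycle_pds_on adj' (f ` S)"
proof -
  have inj: "f u = f v \<longleftrightarrow> u = v" for u v
    using f by (simp add: bij_is_inj inj_eq)
  have "perfect_dominating adj' (f ` S)"
    unfolding perfect_dominating_def
  proof (intro allI impI)
    fix v assume "v \<notin> f ` S"
    moreover obtain u where v: "v = f u" using f by (metis bij_pointE)
    ultimately have "u \<notin> S" by blast
    then obtain w where w: "w \<in> S" "adj u w" "\<And>w'. w' \<in> S \<Longrightarrow> adj u w' \<Longrightarrow> w' = w"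
      using S unfolding four_cycle_pds_on_def perfect_dominating_def by metis
    show "\<exists>!w. w \<in> f ` S \<and> adj' v w"
    proof (rule ex1I[of _ "f w"])
      show "f w \<in> f ` S \<and> adj' v (f w)" using w(1,2) by (simp add: v adj)
    next
      fix w' assume "w' \<in> f ` S \<and> adj' v w'"
      then obtain w'' where "w' = f w''" "w'' \<in> S" "adj u w''" by (auto simp: v adj)
      then show "w' = f w" using w(3) by blast
    qed
  qed
  moreover have "induces_cycle adj' 4 C" if C: "C \<in> induced_components adj' (f ` S)" for C
  proof -
    obtain u where u: "u \<in> S" and Cu: "C = {v. (induced adj' (f ` S))\<^sup>*\<^sup>* (f u) v}"
      using C unfolding induced_components_def by blast
    define D where "D = {v. (induced adj S)\<^sup>*\<^sup>* u v}"
    have "C = f ` D"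
    proof (intro equalityI subsetI)
      fix v assume "v \<in> C"
      moreover obtain w where w: "v = f w" using f by (metis bij_pointE)
      ultimately have "(induced adj' (f ` S))\<^sup>*\<^sup>* (f u) (f w)" by (simp add: Cu)
      \<comment> \<open>Walks are pulled back along \<open>inv f\<close>; this gives the inclusion
        of the component in the image of \<open>D\<close>.\<close>
      moreover have "adj (inv f v) (inv f w)" if "adj' v w" for v w
        using that adj f by (metis bij_inv_eq_iff)
      ultimately have "(induced adj (inv f ` f ` S))\<^sup>*\<^sup>* (inv f (f u)) (inv f (f w))"
        by (rule induced_reachable_image[rotated])
      then have "w \<in> D"
        using f by (simp add: D_def bij_is_inj image_comp)
      then show "v \<in> f ` D" using w by blast
    next
      fix v assume "v \<in> f ` D"
      then show "v \<in> C"
        using induced_reachable_image[of adj adj' f S u] adj by (auto simp: D_def Cu)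
    qed
    moreover have "induces_cycle adj 4 D"
      using S u unfolding four_cycle_pds_on_def induced_components_def D_def by blast
    then obtain g where "bij_betw g {..<4} D" "\<forall>i<4. \<forall>j<4. adj (g i) (g j) \<longleftrightarrow> cycle_adj 4 i j"
      unfolding induces_cycle_def by blast
    ultimately show ?thesis
      unfolding induces_cycle_def using f adj
      by (intro exI[of _ "f \<circ> g"]) (auto intro: bij_betw_trans bij_betw_subset)
  qed
  ultimately show ?thesis unfolding four_cycle_pds_on_def by blast
qed

lemma grid_iff:
  "grid (x, y, z) q \<longleftrightarrow> q \<in> {(x + 1, y, z), (x - 1, y, z), (x, y + 1, z), (x, y - 1, z), (x, y, z + 1), (x, y, z - 1)}"
  (is "?L \<longleftrightarrow> ?R")
proof
  assume ?L
  moreover obtain a b c where q: "q = (x + a, y + b, z + c)"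
    by (metis prod_cases3 add.commute diff_add_cancel)
  ultimately have "\<bar>a\<bar> + \<bar>b\<bar> + \<bar>c\<bar> = 1" by (simp add: grid_def)
  moreover from this have "a = - 1 \<or> a = 0 \<or> a = 1" "b = - 1 \<or> b = 0 \<or> b = 1"
    "c = - 1 \<or> c = 0 \<or> c = 1"
    by linarith+
  ultimately have "(a, b, c) \<in> {(1, 0, 0), (- 1, 0, 0), (0, 1, 0), (0, - 1, 0), (0, 0, 1), (0, 0, - 1)}"
    by (elim disjE) simp_all
  then show ?R by (auto simp: q)
qed (auto simp: grid_def)

lemma grid_sym: "grid p q \<longleftrightarrow> grid q p"
  by (cases p; cases q) (auto simp: grid_def abs_minus_commute)

text \<open>A unit step towards \<open>q\<close> in a coordinate where the points differ. The
  resulting common neighbour is what forbids two squares at distance 2.\<close>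

lemma grid_between:
  assumes "grid_dist p q = 2"
  shows "\<exists>r. grid p r \<and> grid r q"
proof -
  obtain x y z x' y' z' where p: "p = (x, y, z)" and q: "q = (x', y', z')" by (metis prod_cases3)
  consider "x \<noteq> x'" | "x = x'" "y \<noteq> y'" | "x = x'" "y = y'" by blast
  then show ?thesis
  proof cases
    case 1
    then show ?thesis using assms
      by (intro exI[of _ "(x + sgn (x' - x), y, z)"]) (auto simp: p q grid_def sgn_if)
  next
    case 2
    then show ?thesis using assms
      by (intro exI[of _ "(x, y + sgn (y' - y), z)"]) (auto simp: p q grid_def sgn_if)
  next
    case 3
    then show ?thesis using assms
      by (intro exI[of _ "(x, y, z + sgn (z' - z))"]) (auto simp: p q grid_def sgn_if)
  qed
qed

lemma grid_dist_nonneg: "0 \<le> grid_dist p q"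
  by (cases p; cases q) auto

lemma grid_dist_eq_0: "grid_dist p q = 0 \<longleftrightarrow> p = q"
  by (cases p; cases q) auto

definition unit_vectors :: "point set" where
  "unit_vectors = {(1, 0, 0), (- 1, 0, 0), (0, 1, 0), (0, - 1, 0), (0, 0, 1), (0, 0, - 1)}"

lemma grid_unit_vector:
  assumes "grid p q"
  obtains d where "d \<in> unit_vectors" "q = p + d"
proof -
  obtain x y z where p: "p = (x, y, z)" by (metis prod_cases3)
  have "q - p \<in> unit_vectors"
    using assms unfolding p grid_iff unit_vectors_def by (auto simp: zero_prod_def)
  then show thesis by (intro that[of "q - p"]) auto
qed

lemma grid_add: "grid (p + d) (p + e) \<longleftrightarrow> grid d e"
  by (cases p; cases d; cases e) (simp add: grid_def)

text \<open>The sum of the three unit vectors \<open>d\<close>, \<open>f\<close> and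
  \<open>- e\<close> is again a unit vector only if two of them cancel. The hypotheses rule out
  every pair but \<open>f\<close> and \<open>- e\<close>; and \<open>e = - d\<close> would then make
  \<open>d + f\<close> vanish.\<close>

lemma unit_vectors_diagonal:
  assumes "d \<in> unit_vectors" "e \<in> unit_vectors" "f \<in> unit_vectors" "grid (d + f) e"
    "d + f \<noteq> (0, 0, 0)" "d \<noteq> e"
  shows "f = e \<and> d + e \<noteq> (0, 0, 0)"
  using assms unfolding unit_vectors_def
  by (elim insertE emptyE; simp add: grid_def)

lemma unit_vectors_square:
  assumes "d \<in> unit_vectors" "e \<in> unit_vectors" "d \<noteq> e" "d + e \<noteq> (0, 0, 0)"
  shows "\<exists>t. {(x, y, z), (x, y, z) + d, (x, y, z) + d + e, (x, y, z) + e} = square t"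
proof -
  obtain a b c a' b' c' where d: "d = (a, b, c)" and e: "e = (a', b', c')" by (metis prod_cases3)
  \<comment> \<open>Being neither equal nor opposite, \<open>d\<close> and \<open>e\<close> are
    perpendicular. Adding their negative components yields the least corner, and the axis is the
    coordinate in which both vanish.\<close>
  have "{(x, y, z), (x, y, z) + d, (x, y, z) + d + e, (x, y, z) + e} =
      square (x + min 0 (a + a'), y + min 0 (b + b'), z + min 0 (c + c'),
        if a = 0 \<and> a' = 0 then AX else if b = 0 \<and> b' = 0 then AY else AZ)"
    using assms unfolding unit_vectors_def d e
    by (elim insertE emptyE; simp; simp add: square_AX square_AY square_AZ; blast)
  then show ?thesis by blast
qed

lemma four_cycle_is_square:
  assumes "grid p q" "grid q r" "grid r s" "grid s p" "p \<noteq> r" "q \<noteq> s"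
  shows "\<exists>t. {p, q, r, s} = square t"
proof -
  obtain x y z where p: "p = (x, y, z)" by (metis prod_cases3)
  obtain d where d: "d \<in> unit_vectors" "q = p + d" using assms grid_unit_vector by blast
  obtain e where e: "e \<in> unit_vectors" "s = p + e" using assms grid_unit_vector grid_sym by metis
  obtain f where f: "f \<in> unit_vectors" "r = p + (d + f)"
    using assms grid_unit_vector[of q r] d(2) by (metis add.assoc)
  have "f = e \<and> d + e \<noteq> (0, 0, 0)"
    using assms d e f by (intro unit_vectors_diagonal) (auto simp: grid_add simp flip: zero_prod_def)
  then show ?thesis
    using unit_vectors_square[of d e x y z] assms d e f by (auto simp: p add.assoc)
qed

lemma card_square: "card (square t) = 4"
proof -
  obtain x y z k where t: "t = (x, y, z, k)" by (metis prod_cases4)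
  show ?thesis by (cases k) (simp_all add: t square_AX square_AY square_AZ)
qed

lemma induces_cycle_is_square:
  assumes "induces_cycle grid 4 C"
  shows "\<exists>t. C = square t"
proof -
  obtain f where f: "bij_betw f {..<4} C" and adj: "\<forall>i<4. \<forall>j<4. grid (f i) (f j) \<longleftrightarrow> cycle_adj 4 i j"
    using assms unfolding induces_cycle_def by blast
  have "{..<4} = {0, 1, 2, 3 :: nat}" by auto
  then have "C = {f 0, f 1, f 2, f 3}" using f by (simp add: bij_betw_def)
  moreover have "f 0 \<noteq> f 2" "f 1 \<noteq> f 3"
    using f inj_on_eq_iff[of f "{..<4}"] by (auto simp: bij_betw_def)
  moreover have "grid (f 0) (f 1)" "grid (f 1) (f 2)" "grid (f 2) (f 3)" "grid (f 3) (f 0)"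
    using adj by (simp_all add: cycle_adj_def)
  ultimately show ?thesis using four_cycle_is_square by metis
qed

subsection \<open>Perfect dominating sets as tilings\<close>

lemma grid_connected_square:
  assumes S: "four_cycle_pds_on grid S" and p: "p \<in> S"
  obtains t where "{q. (induced grid S)\<^sup>*\<^sup>* p q} = square t" "square t \<subseteq> S" "p \<in> square t"
proof -
  define C where "C = {q. (induced grid S)\<^sup>*\<^sup>* p q}"
  have "induces_cycle grid 4 C"
    using S p unfolding four_cycle_pds_on_def induced_components_def C_def by blast
  then obtain t where t: "C = square t" using induces_cycle_is_square by blast
  have "q \<in> S" if "(induced grid S)\<^sup>*\<^sup>* p q" for q
    using that p by (induction) (auto simp: induced_def)
  then have "C \<subseteq> S" unfolding C_def by blast
  then show thesis using that[of t] t unfolding C_def by auto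
qed

lemma finite_square: "finite (square t)"
  using card_square[of t] by (metis card.infinite zero_neq_numeral)

lemma square_is_cycle:
  obtains a b c d where "square t = {a, b, c, d}" "grid a b" "grid b c" "grid c d" "grid d a"
proof -
  obtain x y z k where t: "t = (x, y, z, k)" by (metis prod_cases4)
  show thesis
  proof (cases k)
    case AX
    then show thesis
      by (intro that[of "(x, y, z)" "(x, y + 1, z)" "(x, y + 1, z + 1)" "(x, y, z + 1)"])
        (simp_all add: t square_AX grid_def)
  next
    case AY
    then show thesis
      by (intro that[of "(x, y, z)" "(x + 1, y, z)" "(x + 1, y, z + 1)" "(x, y, z + 1)"])
        (simp_all add: t square_AY grid_def)
  next
    case AZ
    then show thesis
      by (intro that[of "(x, y, z)" "(x + 1, y, z)" "(x + 1, y + 1, z)" "(x, y + 1, z)"])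
        (simp_all add: t square_AZ grid_def)
  qed
qed

lemma square_reachable:
  assumes "p \<in> square t" "q \<in> square t" "square t \<subseteq> S"
  shows "(induced grid S)\<^sup>*\<^sup>* p q"
proof -
  obtain a b c d where t: "square t = {a, b, c, d}" and e: "grid a b" "grid b c" "grid c d" "grid d a"
    by (rule square_is_cycle)
  have *: "induced grid S a b" "induced grid S b c" "induced grid S c d" "induced grid S d a"
    using e assms(3) unfolding t induced_def by simp_all
  have da: "(induced grid S)\<^sup>*\<^sup>* d a" using *(4) by (rule r_into_rtranclp)
  have ca: "(induced grid S)\<^sup>*\<^sup>* c a" using *(3) da by (rule converse_rtranclp_into_rtranclp)
  have ba: "(induced grid S)\<^sup>*\<^sup>* b a" using *(2) ca by (rule converse_rtranclp_into_rtranclp)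
  have ab: "(induced grid S)\<^sup>*\<^sup>* a b" using *(1) by (rule r_into_rtranclp)
  have ac: "(induced grid S)\<^sup>*\<^sup>* a c" using ab *(2) by (rule rtranclp.rtrancl_into_rtrancl)
  have ad: "(induced grid S)\<^sup>*\<^sup>* a d" using ac *(3) by (rule rtranclp.rtrancl_into_rtrancl)
  have "(induced grid S)\<^sup>*\<^sup>* p a" using assms(1) ba ca da unfolding t by blast
  moreover have "(induced grid S)\<^sup>*\<^sup>* a q" using assms(2) ab ac ad unfolding t by blast
  ultimately show ?thesis by (rule rtranclp_trans)
qed

text \<open>The component of \<open>p\<close> is itself a square and contains
  \<open>square t\<close>, because a square is connected; both have four points. So each square
  inside \<open>S\<close> is an entire component.\<close>

lemma component_eq_square:
  assumes S: "four_cycle_pds_on grid S" and t: "square t \<subseteq> S" "p \<in> square t"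
  shows "{q. (induced grid S)\<^sup>*\<^sup>* p q} = square t"
proof -
  have "p \<in> S" using t by blast
  then obtain u where u: "{q. (induced grid S)\<^sup>*\<^sup>* p q} = square u"
    using grid_connected_square[OF S] by metis
  have "square t \<subseteq> square u"
    unfolding u[symmetric] using square_reachable t by blast
  then have "square t = square u"
    by (intro card_subset_eq finite_square) (simp_all add: card_square)
  then show ?thesis using u by simp
qed

text \<open>Domination gives the covering. For the separation, distance 0 or 1 would merge two
  components; at distance 2 a common neighbour of the nearest points would merge them if it lies in
  \<open>S\<close>, and would be dominated twice if it does not.\<close>

lemma tiling_of_pds:
  assumes S: "four_cycle_pds_on grid S"
  shows "tiling {t. square t \<subseteq> S}"
  unfolding tiling_def
proof (intro conjI allI ballI impI)
  have dom: "\<exists>!w. w \<in> S \<and> grid v w" if "v \<notin> S" for v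
    using S that unfolding four_cycle_pds_on_def perfect_dominating_def by blast
  fix p
  obtain q where q: "q \<in> S" "grid_dist p q \<le> 1"
  proof (cases "p \<in> S")
    case True
    then show thesis using that[of p] grid_dist_eq_0[of p p] by simp
  next
    case False
    then obtain q where "q \<in> S" "grid p q" using dom by blast
    then show thesis using that[of q] by (simp add: grid_def)
  qed
  then obtain t where t: "square t \<subseteq> S" "q \<in> square t"
    using grid_connected_square[OF S] by metis
  then have "point_gap p t \<le> 1"
    using point_gap_le[of q t p] q by linarith
  then show "\<exists>t\<in>{t. square t \<subseteq> S}. point_gap p t \<le> 1"
    using t by blast
next
  have dom: "\<exists>!w. w \<in> S \<and> grid v w" if "v \<notin> S" for v
    using S that unfolding four_cycle_pds_on_def perfect_dominating_def by blast
  fix t u assume tu: "t \<in> {t. square t \<subseteq> S}" "u \<in> {t. square t \<subseteq> S}" "t \<noteq> u"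
  obtain p q where pq: "p \<in> square t" "q \<in> square u" "grid_dist p q = tile_gap t u"
    using tile_gap_attained by metis
  have comp: "{q. (induced grid S)\<^sup>*\<^sup>* p q} = square t" "{p. (induced grid S)\<^sup>*\<^sup>* q p} = square u"
    using component_eq_square[OF S] tu pq by auto
  have apart: "\<not> (induced grid S)\<^sup>*\<^sup>* p q"
  proof
    assume "(induced grid S)\<^sup>*\<^sup>* p q"
    then have "q \<in> square t" using comp by blast
    then have "square u = square t"
      using comp(2) component_eq_square[OF S, of t q] tu by auto
    then show False using square_inject tu by metis
  qed
  have S': "p \<in> S" "q \<in> S" using pq tu by auto
  show "2 < tile_gap t u"
  proof (rule ccontr)
    assume "\<not> 2 < tile_gap t u"
    then consider "grid_dist p q = 0" | "grid_dist p q = 1" | "grid_dist p q = 2"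
      using pq(3) grid_dist_nonneg[of p q] by linarith
    then show False
    proof cases
      case 1
      then show False using apart by (simp add: grid_dist_eq_0)
    next
      case 2
      then show False using apart S' by (auto simp: induced_def grid_def)
    next
      case 3
      then obtain r where r: "grid p r" "grid r q" using grid_between by blast
      show False
      proof (cases "r \<in> S")
        case True
        then have "induced grid S p r" "induced grid S r q" using r S' by (auto simp: induced_def)
        then show False using apart by (meson r_into_rtranclp rtranclp_trans)
      next
        case False
        then have "p = q" using dom[of r] r S' grid_sym by blast
        then show False using apart by simp
      qed
    qed
  qed
qed

text \<open>If the least corner of a horizontal square has residue 0, the four corners have residues
  0, 5, -6 and -1 modulo 20.\<close>

definition lattice_pds :: "point set" where
  "lattice_pds = {p. residue p \<in> {0, 5, 14, 19}}"

lemma residue_neighbours: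
  "residue (x + 1, y, z) = (residue (x, y, z) + 5) mod 20"
  "residue (x - 1, y, z) = (residue (x, y, z) - 5) mod 20"
  "residue (x, y + 1, z) = (residue (x, y, z) - 6) mod 20"
  "residue (x, y - 1, z) = (residue (x, y, z) + 6) mod 20"
  "residue (x, y, z + 1) = (residue (x, y, z) + 2) mod 20"
  "residue (x, y, z - 1) = (residue (x, y, z) - 2) mod 20"
  by (simp_all add: mod_simps algebra_simps)

lemma residue_range: "residue p \<in> {0..<20}"
  by (cases p) simp

lemma lattice_pds_square:
  assumes "p \<in> lattice_pds"
  obtains v where "residue v = 0" "p \<in> square (flat v)"
proof -
  obtain x y z where p: "p = (x, y, z)" by (metis prod_cases3)
  consider "residue p = 0" | "residue p = 5" | "residue p = 14" | "residue p = 19"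
    using assms unfolding lattice_pds_def by blast
  then show thesis
  proof cases
    case 1
    then show thesis using that[of p] by (simp add: p square_AZ)
  next
    case 2
    then show thesis using that[of "(x - 1, y, z)"] residue_neighbours(2)[of x y z]
      by (simp add: p square_AZ del: residue.simps)
  next
    case 3
    then show thesis using that[of "(x, y - 1, z)"] residue_neighbours(4)[of x y z]
      by (simp add: p square_AZ del: residue.simps)
  next
    case 4
    then show thesis
      using that[of "(x - 1, y - 1, z)"] residue_neighbours(4)[of x y z] residue_neighbours(2)[of x "y - 1" z]
      by (simp add: p square_AZ del: residue.simps)
  qed
qed

lemma square_residues:
  assumes "residue (x, y, z) = 0"
  shows "residue (x + 1, y, z) = 5" "residue (x, y + 1, z) = 14" "residue (x + 1, y + 1, z) = 19"
  using assms residue_neighbours(1,3)[of x y z] residue_neighbours(1)[of x "y + 1" z]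
  by (simp_all del: residue.simps)

lemma square_subset_lattice_pds:
  assumes "residue v = 0"
  shows "square (flat v) \<subseteq> lattice_pds"
  using assms square_residues
  by (cases v) (auto simp: square_AZ lattice_pds_def simp del: residue.simps)

text \<open>From each of the residues 0, 5, 14, 19 exactly two of the six steps by 5, 6 or 2 in
  either direction stay among them, and these two lead along the edges of the square.\<close>

lemma square_closed_lattice_pds:
  assumes v: "residue v = 0" and p: "p \<in> square (flat v)" and q: "grid p q" "q \<in> lattice_pds"
  shows "q \<in> square (flat v)"
proof -
  obtain x y z where xyz: "v = (x, y, z)" by (metis prod_cases3)
  have r: "residue (x, y, z) = 0" using v by (simp add: xyz)
  note R = r square_residues[OF r]
  consider "p = (x, y, z)" | "p = (x + 1, y, z)" | "p = (x + 1, y + 1, z)" | "p = (x, y + 1, z)"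
    using p by (auto simp: xyz square_AZ)
  then show ?thesis
  proof cases
    case 1
    show ?thesis
      using q(1) unfolding 1 grid_iff
      by (elim insertE emptyE)
        (use q(2) R residue_neighbours[of x y z] in
          \<open>simp_all add: lattice_pds_def xyz square_AZ del: residue.simps\<close>)
  next
    case 2
    show ?thesis
      using q(1) unfolding 2 grid_iff
      by (elim insertE emptyE)
        (use q(2) R residue_neighbours[of "x + 1" y z] in
          \<open>simp_all add: lattice_pds_def xyz square_AZ del: residue.simps\<close>)
  next
    case 3
    show ?thesis
      using q(1) unfolding 3 grid_iff
      by (elim insertE emptyE)
        (use q(2) R residue_neighbours[of "x + 1" "y + 1" z] in
          \<open>simp_all add: lattice_pds_def xyz square_AZ del: residue.simps\<close>)
  next
    case 4
    show ?thesis
      using q(1) unfolding 4 grid_iff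
      by (elim insertE emptyE)
        (use q(2) R residue_neighbours[of x "y + 1" z] in
          \<open>simp_all add: lattice_pds_def xyz square_AZ del: residue.simps\<close>)
  qed
qed

lemma square_induces_cycle: "induces_cycle grid 4 (square (flat v))"
proof -
  obtain x y z where v: "v = (x, y, z)" by (metis prod_cases3)
  define f where "f i = [(x, y, z), (x + 1, y, z), (x + 1, y + 1, z), (x, y + 1, z)] ! i" for i
  have f: "f 0 = (x, y, z)" "f 1 = (x + 1, y, z)" "f 2 = (x + 1, y + 1, z)" "f 3 = (x, y + 1, z)"
    by (simp_all add: f_def)
  have n: "{..<4} = {0, 1, 2, 3 :: nat}" by auto
  have "bij_betw f {..<4} (square (flat v))"
    unfolding n by (auto simp: bij_betw_def f v square_AZ simp flip: One_nat_def)
  moreover have "\<forall>i\<in>{..<4}. \<forall>j\<in>{..<4}. grid (f i) (f j) \<longleftrightarrow> cycle_adj 4 i j"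
    unfolding n by (simp add: f grid_def cycle_adj_def flip: One_nat_def)
  ultimately show ?thesis unfolding induces_cycle_def by blast
qed

lemma four_cycle_pds_lattice_pds: "four_cycle_pds_on grid lattice_pds"
proof -
  have "\<exists>!w. w \<in> lattice_pds \<and> grid v w" if v: "v \<notin> lattice_pds" for v
  proof -
    obtain x y z where xyz: "v = (x, y, z)" by (metis prod_cases3)
    define r where "r = residue v"
    let ?M = "{0, 5, 14, 19} :: int set"
    \<comment> \<open>Membership of a neighbour depends only on \<open>r\<close>, so domination
      reduces to the 16 remaining residues: from each of them exactly one step leads into
      \<open>?M\<close>.\<close>
    have eq: "w \<in> lattice_pds \<and> grid v w \<longleftrightarrow>
        w = (x + 1, y, z) \<and> (r + 5) mod 20 \<in> ?M \<or> w = (x - 1, y, z) \<and> (r - 5) mod 20 \<in> ?M \<or>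
        w = (x, y + 1, z) \<and> (r - 6) mod 20 \<in> ?M \<or> w = (x, y - 1, z) \<and> (r + 6) mod 20 \<in> ?M \<or>
        w = (x, y, z + 1) \<and> (r + 2) mod 20 \<in> ?M \<or> w = (x, y, z - 1) \<and> (r - 2) mod 20 \<in> ?M" for w
      unfolding xyz grid_iff lattice_pds_def r_def residue_neighbours[symmetric] by blast
    have "r \<in> {0..<20}" "r \<notin> ?M"
      using v residue_range unfolding r_def lattice_pds_def by blast+
    then have "r \<in> {1, 2, 3, 4, 6, 7, 8, 9, 10, 11, 12, 13, 15, 16, 17, 18}" by simp arith
    then show ?thesis unfolding eq by (elim insertE emptyE) simp_all
  qed
  moreover have "induces_cycle grid 4 C" if C: "C \<in> induced_components grid lattice_pds" for C
  proof -
    obtain p where p: "p \<in> lattice_pds" and Cp: "C = {q. (induced grid lattice_pds)\<^sup>*\<^sup>* p q}"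
      using C unfolding induced_components_def by blast
    obtain v where v: "residue v = 0" "p \<in> square (flat v)" using lattice_pds_square[OF p] .
    have "q \<in> square (flat v)" if "(induced grid lattice_pds)\<^sup>*\<^sup>* p q" for q
      using that
    proof induction
      case (step q r)
      then show ?case using square_closed_lattice_pds[OF v(1)] unfolding induced_def by blast
    qed (rule v(2))
    moreover have "(induced grid lattice_pds)\<^sup>*\<^sup>* p q" if "q \<in> square (flat v)" for q
      by (rule square_reachable[OF v(2) that square_subset_lattice_pds[OF v(1)]])
    ultimately have "C = square (flat v)" unfolding Cp by blast
    then show ?thesis using square_induces_cycle by simp
  qed
  ultimately show ?thesis unfolding four_cycle_pds_on_def perfect_dominating_def by blast
qed

text \<open>The star forces all lattice squares into \<open>S\<close>, and nothing more fits: as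
  \<open>lattice_pds\<close> is dominating, a further point of \<open>S\<close> would be adjacent to
  a lattice square, so its own square would be too close.\<close>

lemma eq_lattice_pds:
  assumes S: "four_cycle_pds_on grid S" and star: "starred {t. square t \<subseteq> S} (0, 0, 0)"
  shows "S = lattice_pds"
proof -
  let ?T = "{t. square t \<subseteq> S}"
  have T: "tiling ?T" by (rule tiling_of_pds[OF S])
  have lattice: "flat v \<in> ?T" if "residue v = 0" for v
    by (rule starred_lattice[OF T star that])
  have "lattice_pds \<subseteq> S"
  proof
    fix p assume "p \<in> lattice_pds"
    then obtain v where "residue v = 0" "p \<in> square (flat v)" by (rule lattice_pds_square)
    then show "p \<in> S" using lattice[of v] by blast
  qed
  moreover have "p \<in> lattice_pds" if p: "p \<in> S" for p
  proof (rule ccontr)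
    assume n: "p \<notin> lattice_pds"
    then obtain w where w: "w \<in> lattice_pds" "grid p w"
      using four_cycle_pds_lattice_pds unfolding four_cycle_pds_on_def perfect_dominating_def by blast
    obtain v where v: "residue v = 0" "w \<in> square (flat v)" using lattice_pds_square[OF w(1)] .
    obtain t where t: "square t \<subseteq> S" "p \<in> square t"
      using grid_connected_square[OF S p] by metis
    have "tile_gap t (flat v) \<le> 1"
      using tile_gap_le[OF t(2) v(2)] w(2) by (simp add: grid_def)
    moreover have "t \<in> ?T" "flat v \<in> ?T" using t(1) lattice[OF v(1)] by simp_all
    ultimately have "t = flat v"
      using T unfolding tiling_def by (metis (no_types, lifting) not_le order.trans one_le_numeral)
    then show False using t(2) n square_subset_lattice_pds[OF v(1)] by blast
  qed
  ultimately show ?thesis by blast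
qed

subsection \<open>Lattice motions\<close>

definition to_vec :: "point \<Rightarrow> int ^ 3" where
  "to_vec = (\<lambda>(x, y, z). vector [x, y, z])"

lemma to_vec_nth [simp]:
  "to_vec (x, y, z) $ 1 = x" "to_vec (x, y, z) $ 2 = y" "to_vec (x, y, z) $ 3 = z"
  by (simp_all add: to_vec_def)

lemma bij_to_vec: "bij to_vec"
proof (rule o_bij[of "\<lambda>v. (v $ 1, v $ 2, v $ 3)"])
  show "(\<lambda>v. (v $ 1, v $ 2, v $ 3)) \<circ> to_vec = id" by (auto simp: fun_eq_iff)
  show "to_vec \<circ> (\<lambda>v. (v $ 1, v $ 2, v $ 3)) = id" by (auto simp: fun_eq_iff vec_eq_iff forall_3)
qed

lemma Lambda3_iff: "Lambda3 u v \<longleftrightarrow> (\<Sum>i\<in>UNIV. (u $ i - v $ i)\<^sup>2) = 1"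
proof -
  have "Lambda3 u v \<longleftrightarrow> (\<Sum>i\<in>UNIV. (real_of_int (u $ i) - real_of_int (v $ i))\<^sup>2) = 1"
    by (simp add: Lambda3_def dist_vec_def L2_set_def dist_real_def embed_def)
  also have "(\<Sum>i\<in>UNIV. (real_of_int (u $ i) - real_of_int (v $ i))\<^sup>2) =
      real_of_int (\<Sum>i\<in>UNIV. (u $ i - v $ i)\<^sup>2)"
    by simp
  finally show ?thesis by linarith
qed

text \<open>Over the integers both sides say that one entry is 1 or -1 and the others vanish. This
  identifies the Euclidean unit distance with adjacency in \<open>grid\<close>.\<close>

lemma sum_squares_eq_1_iff:
  fixes a b c :: int
  shows "a\<^sup>2 + b\<^sup>2 + c\<^sup>2 = 1 \<longleftrightarrow> \<bar>a\<bar> + \<bar>b\<bar> + \<bar>c\<bar> = 1"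
proof (cases "\<bar>a\<bar> \<le> 1 \<and> \<bar>b\<bar> \<le> 1 \<and> \<bar>c\<bar> \<le> 1")
  case True
  then have "a = - 1 \<or> a = 0 \<or> a = 1" "b = - 1 \<or> b = 0 \<or> b = 1" "c = - 1 \<or> c = 0 \<or> c = 1"
    by linarith+
  then show ?thesis by (elim disjE) simp_all
next
  case False
  then have "\<not> a\<^sup>2 \<le> 1 \<or> \<not> b\<^sup>2 \<le> 1 \<or> \<not> c\<^sup>2 \<le> 1" by (simp add: abs_square_le_1)
  moreover have "0 \<le> a\<^sup>2" "0 \<le> b\<^sup>2" "0 \<le> c\<^sup>2" by simp_all
  ultimately show ?thesis using False by linarith
qed

lemma Lambda3_to_vec: "Lambda3 (to_vec p) (to_vec q) \<longleftrightarrow> grid p q"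
  by (cases p; cases q) (simp add: Lambda3_iff sum_3 sum_squares_eq_1_iff grid_def)

lemma sign_times_self: "(\<forall>i. s i \<in> {1, - 1}) \<Longrightarrow> s i * s i = (1 :: int)"
  by (metis insert_iff singletonD mult_1 mult_minus_left mult_minus_right minus_minus)

lemma lattice_motion_inverse:
  assumes "lattice_motion f"
  obtains f' where "lattice_motion f'" "f' \<circ> f = id" "f \<circ> f' = id"
proof -
  obtain p s t where p: "bij p" and s: "\<forall>i. s i \<in> {1, - 1}" and f: "f = (\<lambda>v. t + (\<chi> i. s i * v $ p i))"
    using assms unfolding lattice_motion_def by blast
  define q where "q = inv p"
  have pq: "p (q i) = i" "q (p i) = i" for i
    using p unfolding q_def by (simp_all add: bij_is_surj surj_f_inv_f bij_is_inj)
  have ss: "s i * (s i * c) = c" for i c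
    using sign_times_self[OF s, of i] by (simp flip: mult.assoc)
  \<comment> \<open>Obtained by solving \<open>w $ i = t $ i + s i * v $ p i\<close> for
    \<open>v\<close>, each sign being its own inverse.\<close>
  define f' where "f' = (\<lambda>v. (\<chi> i. - s (q i) * t $ q i) + (\<chi> i. s (q i) * v $ q i))"
  have "lattice_motion f'"
    unfolding lattice_motion_def f'_def
    using s bij_imp_bij_inv[OF p, folded q_def]
    by (intro exI[of _ q] exI[of _ "\<lambda>i. s (q i)"] exI[of _ "\<chi> i. - s (q i) * t $ q i"] conjI)
      simp_all
  moreover have "f' (f v) $ i = v $ i" for v i
    unfolding f f'_def by (simp add: pq distrib_left ss)
  then have "f' \<circ> f = id" by (simp add: fun_eq_iff vec_eq_iff)
  moreover have "f (f' v) $ i = v $ i" for v i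
    unfolding f f'_def by (simp add: pq right_diff_distrib ss)
  then have "f \<circ> f' = id" by (simp add: fun_eq_iff vec_eq_iff)
  ultimately show thesis by (rule that)
qed

lemma lattice_motion_comp:
  assumes "lattice_motion f" "lattice_motion g"
  shows "lattice_motion (f \<circ> g)"
proof -
  obtain p s t where p: "bij p" and s: "\<forall>i. s i \<in> {1, - 1}" and f: "f = (\<lambda>v. t + (\<chi> i. s i * v $ p i))"
    using assms unfolding lattice_motion_def by blast
  obtain p' s' t' where p': "bij p'" and s': "\<forall>i. s' i \<in> {1, - 1}"
    and g: "g = (\<lambda>v. t' + (\<chi> i. s' i * v $ p' i))"
    using assms unfolding lattice_motion_def by blast
  \<comment> \<open>Coordinates are read at \<open>p i\<close>, so the index permutations compose in
    the opposite order and the inner signs are taken at \<open>p i\<close>.\<close>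
  have "f \<circ> g = (\<lambda>v. (t + (\<chi> i. s i * t' $ p i)) + (\<chi> i. (s i * s' (p i)) * v $ (p' \<circ> p) i))"
    by (simp add: fun_eq_iff vec_eq_iff f g algebra_simps)
  moreover have "\<forall>i. s i * s' (p i) \<in> {1, - 1}"
    using s s' by (metis insert_iff singletonD mult_1 mult_minus_left minus_minus empty_iff)
  ultimately show ?thesis
    unfolding lattice_motion_def using bij_comp[OF p p']
    by (intro exI[of _ "p' \<circ> p"] exI[of _ "\<lambda>i. s i * s' (p i)"] exI[of _ "t + (\<chi> i. s i * t' $ p i)"] conjI)
qed

lemma lattice_motion_automorphism:
  assumes "lattice_motion f"
  shows "graph_automorphism Lambda3 f"
proof -
  obtain p s t where p: "bij p" and s: "\<forall>i. s i \<in> {1, - 1}" and f: "f = (\<lambda>v. t + (\<chi> i. s i * v $ p i))"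
    using assms unfolding lattice_motion_def by blast
  have "(f u $ i - f v $ i)\<^sup>2 = (u $ p i - v $ p i)\<^sup>2" for u v i
  proof -
    have "(s i)\<^sup>2 = 1" using sign_times_self[OF s] by (simp add: power2_eq_square)
    moreover have "f u $ i - f v $ i = s i * (u $ p i - v $ p i)" by (simp add: f algebra_simps)
    ultimately show ?thesis by (simp add: power_mult_distrib)
  qed
  then have "(\<Sum>i\<in>UNIV. (f u $ i - f v $ i)\<^sup>2) = (\<Sum>i\<in>UNIV. (u $ i - v $ i)\<^sup>2)" for u v
    using sum.reindex_bij_betw[OF p, of "\<lambda>i. (u $ i - v $ i)\<^sup>2"] by simp
  then have "Lambda3 (f u) (f v) \<longleftrightarrow> Lambda3 u v" for u v by (simp add: Lambda3_iff)
  moreover have "bij f" using lattice_motion_inverse[OF assms] o_bij by metis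
  ultimately show ?thesis unfolding graph_automorphism_def by blast
qed

definition motion :: "(point \<Rightarrow> point) \<Rightarrow> bool" where
  "motion g \<longleftrightarrow> (\<exists>f. lattice_motion f \<and> (\<forall>v. to_vec (g v) = f (to_vec v)))"

lemma motionI:
  assumes "inj p" "\<forall>i. s i \<in> {1, - 1}"
    "\<And>x y z. \<forall>i. to_vec (g (x, y, z)) $ i = t $ i + s i * to_vec (x, y, z) $ p i"
  shows "motion g"
proof -
  have "bij p" using assms(1) by (simp add: bij_def finite_UNIV_inj_surj)
  then have "lattice_motion (\<lambda>v. t + (\<chi> i. s i * v $ p i))"
    unfolding lattice_motion_def using assms(2) by blast
  moreover have "to_vec (g v) = t + (\<chi> i. s i * to_vec v $ p i)" for v
    using assms(3) by (cases v) (simp add: vec_eq_iff)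
  ultimately show ?thesis unfolding motion_def by blast
qed

lemma motion_swap_xy: "motion swap_xy"
  by (rule motionI[of "\<lambda>i. if i = 1 then 2 else if i = 2 then 1 else 3" "\<lambda>_. 1" _ 0])
    (simp_all add: inj_def forall_3)

lemma motion_flip_z: "motion flip_z"
  by (rule motionI[of id "\<lambda>i. if i = 3 then - 1 else 1" _ 0])
    (simp_all add: forall_3)

lemma motion_comp: "motion f \<Longrightarrow> motion g \<Longrightarrow> motion (f \<circ> g)"
  unfolding motion_def comp_def
  using lattice_motion_comp[unfolded comp_def] by metis

definition motion_of_lattice_pds :: "point set \<Rightarrow> bool" where
  "motion_of_lattice_pds S \<longleftrightarrow> (\<exists>f. lattice_motion f \<and> to_vec ` S = f ` to_vec ` lattice_pds)"

text \<open>Allows \<open>S\<close> to be moved into a convenient position before it is compared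
  with the lattice.\<close>

lemma motion_of_lattice_pds_motion:
  assumes "motion g" "motion_of_lattice_pds (g ` S)"
  shows "motion_of_lattice_pds S"
proof -
  obtain h where h: "lattice_motion h" "\<And>v. to_vec (g v) = h (to_vec v)"
    using assms(1) unfolding motion_def by blast
  obtain f where f: "lattice_motion f" "to_vec ` g ` S = f ` to_vec ` lattice_pds"
    using assms(2) unfolding motion_of_lattice_pds_def by blast
  obtain h' where h': "lattice_motion h'" "h' \<circ> h = id"
    using lattice_motion_inverse[OF h(1)] by metis
  have "to_vec ` S = (h' \<circ> h) ` to_vec ` S" unfolding h'(2) by simp
  also have "\<dots> = h' ` to_vec ` g ` S" by (simp add: image_comp comp_def h(2))
  also have "\<dots> = (h' \<circ> f) ` to_vec ` lattice_pds" unfolding f(2) by (simp add: image_comp comp_assoc)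
  finally show ?thesis
    unfolding motion_of_lattice_pds_def using lattice_motion_comp[OF h'(1) f(1)] by blast
qed

lemma motion_pds:
  assumes g: "motion g" and S: "four_cycle_pds_on grid S"
  shows "four_cycle_pds_on grid (g ` S)"
proof (rule four_cycle_pds_on_image[OF _ _ S])
  obtain f where f: "lattice_motion f" "\<And>v. to_vec (g v) = f (to_vec v)"
    using g unfolding motion_def by blast
  have aut: "bij f" "\<And>u v. Lambda3 (f u) (f v) \<longleftrightarrow> Lambda3 u v"
    using lattice_motion_automorphism[OF f(1)] unfolding graph_automorphism_def by blast+
  have "g = inv to_vec \<circ> f \<circ> to_vec"
    using f(2) bij_to_vec by (auto simp: fun_eq_iff bij_is_inj inv_f_f simp flip: f(2))
  then show "bij g" using aut(1) bij_to_vec by (simp add: bij_comp bij_imp_bij_inv)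
  show "grid (g u) (g v) \<longleftrightarrow> grid u v" for u v
    using aut(2)[of "to_vec u" "to_vec v"] by (simp add: Lambda3_to_vec flip: f(2))
qed

lemma motion_of_lattice_pds_origin:
  assumes S: "four_cycle_pds_on grid S" and o: "square (flat (0, 0, 0)) \<subseteq> S"
  shows "motion_of_lattice_pds S"
proof -
  have base: "motion_of_lattice_pds S'"
    if "four_cycle_pds_on grid S'" "square (flat (0, 0, 0)) \<subseteq> S'" "\<forall>w\<in>set star. square (flat w) \<subseteq> S'" for S'
  proof -
    have "S' = lattice_pds"
      using that by (intro eq_lattice_pds) (simp_all add: starred_def flip: zero_prod_def del: flat.simps)
    moreover have "lattice_motion id"
      unfolding lattice_motion_def
      by (intro exI[of _ id] exI[of _ "\<lambda>_. 1"] exI[of _ 0]) (auto simp: vec_eq_iff)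
    ultimately show ?thesis unfolding motion_of_lattice_pds_def by (intro exI[of _ id]) simp
  qed
  obtain G where G: "G \<in> set (star # other_stars)" "\<forall>w\<in>set G. square (flat w) \<subseteq> S"
    using flat_neighbours[OF tiling_of_pds[OF S], of "(0, 0, 0)"] o
    by (auto simp flip: zero_prod_def simp del: flat.simps)
  then consider "G = star" | h where "h \<in> {swap_xy, flip_z, swap_xy \<circ> flip_z}" "G = map h star"
    by (auto simp: other_stars_def)
  then show ?thesis
  proof cases
    case 1
    then show ?thesis using base S o G by blast
  next
    case 2
    \<comment> \<open>Because \<open>h\<close> is an involution fixing the origin and respecting
      least corners, \<open>h\<close> applied to \<open>S\<close> again contains the square at the
      origin, and its star is \<open>star\<close> itself.\<close>
    have h: "motion h" "square (flat (h v)) = h ` square (flat v)" "h (h v) = v" "h (0, 0, 0) = (0, 0, 0)" for v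
      using 2(1) motion_swap_xy motion_flip_z motion_comp
      by (cases v; auto simp: square_AZ)+
    have "square (flat w) \<subseteq> h ` S" if "w \<in> set star" for w
    proof -
      have "square (flat (h w)) \<subseteq> S" using G(2) that by (simp add: 2(2) del: flat.simps)
      then show ?thesis using h(2)[of "h w"] h(3)[of w] by (metis image_mono)
    qed
    moreover have "square (flat (0, 0, 0)) \<subseteq> h ` S" using h(2,4) o by (metis image_mono)
    ultimately have "motion_of_lattice_pds (h ` S)" using base motion_pds[OF h(1) S] by blast
    then show ?thesis using motion_of_lattice_pds_motion[OF h(1)] by blast
  qed
qed

text \<open>A cyclic permutation brings the coordinate normal to the square into last place, and a
  translation moves the least corner to the origin.\<close>

lemma ex_motion_to_origin: "\<exists>g. motion g \<and> g ` square t = square (flat (0, 0, 0))"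
proof -
  obtain x y z k where t: "t = (x, y, z, k)" by (metis prod_cases4)
  show ?thesis
  proof (cases k)
    case AX
    let ?g = "\<lambda>(a, b, c). (b - y, c - z, a - x)"
    have "motion ?g"
      by (rule motionI[of "\<lambda>i. if i = 1 then 2 else if i = 2 then 3 else 1" "\<lambda>_. 1" _ "to_vec (- y, - z, - x)"])
        (simp_all add: inj_def forall_3)
    then show ?thesis by (intro exI[of _ ?g]) (simp add: t AX square_AX square_AZ)
  next
    case AY
    let ?g = "\<lambda>(a, b, c). (c - z, a - x, b - y)"
    have "motion ?g"
      by (rule motionI[of "\<lambda>i. if i = 1 then 3 else if i = 2 then 1 else 2" "\<lambda>_. 1" _ "to_vec (- z, - x, - y)"])
        (simp_all add: inj_def forall_3)
    then show ?thesis by (intro exI[of _ ?g]) (auto simp: t AY square_AY square_AZ)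
  next
    case AZ
    let ?g = "\<lambda>(a, b, c). (a - x, b - y, c - z)"
    have "motion ?g"
      by (rule motionI[of id "\<lambda>_. 1" _ "to_vec (- x, - y, - z)"]) (simp_all add: forall_3)
    then show ?thesis by (intro exI[of _ ?g]) (simp add: t AZ square_AZ)
  qed
qed

lemma four_cycle_pds_motion_of_lattice_pds:
  assumes S: "four_cycle_pds_on grid S"
  shows "motion_of_lattice_pds S"
proof -
  have "S \<noteq> {}"
    using S unfolding four_cycle_pds_on_def perfect_dominating_def by auto
  then obtain t where t: "square t \<subseteq> S" using grid_connected_square[OF S] by (metis ex_in_conv)
  obtain g where g: "motion g" "g ` square t = square (flat (0, 0, 0))"
    using ex_motion_to_origin by blast
  then have "square (flat (0, 0, 0)) \<subseteq> g ` S" using t by (metis image_mono)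
  then have "motion_of_lattice_pds (g ` S)" using motion_of_lattice_pds_origin motion_pds[OF g(1) S] by blast
  then show ?thesis using motion_of_lattice_pds_motion[OF g(1)] by blast
qed

theorem theorem1:
  shows "\<exists>S. four_cycle_pds S \<and>
    (\<forall>T. four_cycle_pds T \<longrightarrow>
      (\<exists>f. graph_automorphism Lambda3 f \<and> lattice_motion f \<and> T = f ` S))"
proof (intro exI[of _ "to_vec ` lattice_pds"] conjI allI impI)
  have pds: "four_cycle_pds S \<longleftrightarrow> four_cycle_pds_on Lambda3 S" for S
    by (simp add: four_cycle_pds_def four_cycle_pds_on_def)
  show "four_cycle_pds (to_vec ` lattice_pds)"
    unfolding pds
    by (rule four_cycle_pds_on_image[OF bij_to_vec Lambda3_to_vec four_cycle_pds_lattice_pds])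
  fix T assume T: "four_cycle_pds T"
  \<comment> \<open>Uniqueness is proved for triples: \<open>T\<close> is pulled back along
    \<open>to_vec\<close>, and the motion found there already acts on vectors.\<close>
  define S where "S = inv to_vec ` T"
  have TS: "T = to_vec ` S"
    unfolding S_def using bij_to_vec by (simp add: bij_is_surj image_f_inv_f)
  have "four_cycle_pds_on grid S"
    unfolding S_def
  proof (rule four_cycle_pds_on_image)
    show "bij (inv to_vec)" by (rule bij_imp_bij_inv[OF bij_to_vec])
    show "four_cycle_pds_on Lambda3 T" using T pds by blast
    show "grid (inv to_vec u) (inv to_vec v) \<longleftrightarrow> Lambda3 u v" for u v
      using Lambda3_to_vec[of "inv to_vec u" "inv to_vec v"] bij_to_vec
      by (simp add: bij_is_surj surj_f_inv_f)
  qed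
  then obtain f where "lattice_motion f" "T = f ` to_vec ` lattice_pds"
    using four_cycle_pds_motion_of_lattice_pds unfolding motion_of_lattice_pds_def TS by blast
  then show "\<exists>f. graph_automorphism Lambda3 f \<and> lattice_motion f \<and> T = f ` to_vec ` lattice_pds"
    using lattice_motion_automorphism by blast
qed

end
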